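(* Let $X,Z$ be real normed spaces, $K\subset X$ a closed convex pointed cone, and $F:Z\rightrightarrows X$ a set-valued map. Let $A\subset X$ be a nonempty weakly $K$-compact set and $\overline z\in Z$ be such that $\operatorname{cl}F(\overline z)$ is $K$-convex. Then $$\widehat{\partial}\bigl(F(\cdot)+A\bigr)(\overline z)=\widehat{\partial}F(\overline z).$$
   Context: Sums of sets are Minkowski sums; $\operatorname{cl}$ is the norm closure; $D_X$ is the closed unit ball of $X$; $B(Z,X)$ is the space of bounded linear operators from $Z$ to $X$. A cone $K$ is pointed if $K\cap(-K)=\{0\}$. A set $S\subset X$ is $K$-convex if $S+K$ is convex. A nonempty set $A\subset X$ is weakly $K$-compact if from every cover of $A$ by sets of the form $U+K$, with $U\subset X$ weakly open, one can extract a finite subcover. The excess is $e(S,S')=\sup_{x\in S}d(x,S')=\inf\{\alpha>0\mid S\subset S'+\alpha D_X\}$, with $\inf\emptyset=+\infty$. The epigraphical map of a set-valued map $G:Z\rightrightarrows X$ is $\operatorname{Epi}G(z)=G(z)+K$. The Fréchet subdifferential of $G$ at $\overline z\in Z$ is $$\widehat\partial G(\overline z)=\Bigl\{T\in B(Z,X)\ \Big|\ \lim_{z\to\overline z}\frac{e\bigl(\operatorname{Epi}G(z),\operatorname{Epi}G(\overline z)+T(z-\overline z)\bigr)}{\|z-\overline z\|}=0\Bigr\};$$ equivalently, $T\in\widehat\partial G(\overline z)$ iff $T\in B(Z,X)$ and for every $\varepsilon>0$ there is $\delta>0$ such that for all $z\in Z$ with $\|z-\overline z\|<\delta$, $\operatorname{Epi}G(z)\subset\operatorname{Epi}G(\overline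 z)+T(z-\overline z)+\varepsilon\|z-\overline z\|D_X$. The map $F(\cdot)+A$ is $z\mapsto F(z)+A$. *)

theory Defs
  imports "HOL-Analysis.Analysis"
begin

(* The sum of two sets is the Minkowski sum of HOL-Library.Set_Algebras; a translate by v is
   written as S + {v}. Cones are the library's: closed under multiplication by every c \<ge> 0. *)

definition pointed :: "'a::real_vector set \<Rightarrow> bool" where
  "pointed K \<longleftrightarrow> K \<inter> uminus ` K = {0}"

definition K_convex :: "'a::real_vector set \<Rightarrow> 'a set \<Rightarrow> bool" where
  "K_convex K S \<longleftrightarrow> convex (S + K)"

(* The coarsest topology for which every bounded linear functional is continuous. *)
definition weak_topology :: "'a::real_normed_vector topology" where
  "weak_topology =
     topology_generated_by {f -` V | (f :: 'a \<Rightarrow> real) V. bounded_linear f \<and> open V}"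

definition weakly_K_compact :: "'a::real_normed_vector set \<Rightarrow> 'a set \<Rightarrow> bool" where
  "weakly_K_compact K A \<longleftrightarrow>
     (\<forall>\<C>. \<C> \<subseteq> {U + K | U. openin weak_topology U} \<and> A \<subseteq> \<Union>\<C> \<longrightarrow>
          (\<exists>\<D>. \<D> \<subseteq> \<C> \<and> finite \<D> \<and> A \<subseteq> \<Union>\<D>))"

(* The supremum over x in S of the distance d(x, S'). The distance is taken in ennreal rather
   than with infdist, so that d(x, {}) = \<infinity> and the excess of the empty set is 0. *)
definition excess :: "'a::metric_space set \<Rightarrow> 'a set \<Rightarrow> ennreal" where
  "excess S S' = (SUP x\<in>S. INF y\<in>S'. ennreal (dist x y))"

definition Epi :: "'x::plus set \<Rightarrow> ('z \<Rightarrow> 'x set) \<Rightarrow> 'z \<Rightarrow> 'x set" where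
  "Epi K G z = G z + K"

definition frechet_subdiff ::
    "'x::real_normed_vector set \<Rightarrow> ('z::real_normed_vector \<Rightarrow> 'x set) \<Rightarrow> 'z \<Rightarrow> ('z \<Rightarrow>\<^sub>L 'x) set" where
  "frechet_subdiff K G z0 =
     {T. ((\<lambda>z. excess (Epi K G z) (Epi K G z0 + {blinfun_apply T (z - z0)}) / ennreal (norm (z - z0)))
           \<longlongrightarrow> 0) (at z0)}"

lemma mem_plus_scaled_cball:
  fixes x :: "'a::real_normed_vector"
  assumes "0 < \<alpha>"
  shows "x \<in> S + (\<lambda>d. \<alpha> *\<^sub>R d) ` cball 0 1 \<longleftrightarrow> (\<exists>y\<in>S. dist x y \<le> \<alpha>)"
proof
  assume "x \<in> S + (\<lambda>d. \<alpha> *\<^sub>R d) ` cball 0 1"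
  then obtain y d where y: "y \<in> S" and d: "norm d \<le> 1" and x: "x = y + \<alpha> *\<^sub>R d"
    by (auto simp: set_plus_def)
  have "dist x y = \<alpha> * norm d"
    using assms x by (simp add: dist_norm)
  also have "\<dots> \<le> \<alpha>"
    using assms d by (simp add: mult_left_le)
  finally show "\<exists>y\<in>S. dist x y \<le> \<alpha>"
    using y by blast
next
  assume "\<exists>y\<in>S. dist x y \<le> \<alpha>"
  then obtain y where y: "y \<in> S" "dist x y \<le> \<alpha>"
    by blast
  have "x = y + \<alpha> *\<^sub>R ((1 / \<alpha>) *\<^sub>R (x - y))"
    using assms by simp
  moreover have "(1 / \<alpha>) *\<^sub>R (x - y) \<in> cball 0 1"
    using assms y by (simp add: dist_norm del: scaleR_diff_right)
  ultimately show "x \<in> S + (\<lambda>d. \<alpha> *\<^sub>R d) ` cball 0 1"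
    using y by (metis imageI set_plus_intro)
qed

lemma excess_le:
  fixes S S' :: "'a::real_normed_vector set"
  assumes "0 < \<alpha>" and "S \<subseteq> S' + (\<lambda>d. \<alpha> *\<^sub>R d) ` cball 0 1"
  shows "excess S S' \<le> ennreal \<alpha>"
  unfolding excess_def
proof (rule SUP_least)
  fix x assume "x \<in> S"
  then obtain y where y: "y \<in> S'" "dist x y \<le> \<alpha>"
    using assms mem_plus_scaled_cball by blast
  have "(INF y\<in>S'. ennreal (dist x y)) \<le> ennreal (dist x y)"
    using y by (intro INF_lower)
  also have "\<dots> \<le> ennreal \<alpha>"
    using y by (intro ennreal_leI)
  finally show "(INF y\<in>S'. ennreal (dist x y)) \<le> ennreal \<alpha>" .
qed

lemma excess_less_imp_subset:
  fixes S S' :: "'a::real_normed_vector set"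
  assumes "0 < \<alpha>" and "excess S S' < ennreal \<alpha>"
  shows "S \<subseteq> S' + (\<lambda>d. \<alpha> *\<^sub>R d) ` cball 0 1"
proof
  fix x assume "x \<in> S"
  then have "(INF y\<in>S'. ennreal (dist x y)) \<le> excess S S'"
    unfolding excess_def by (intro SUP_upper)
  with assms have "(INF y\<in>S'. ennreal (dist x y)) < ennreal \<alpha>"
    by simp
  then obtain y where "y \<in> S'" "ennreal (dist x y) < ennreal \<alpha>"
    by (auto simp: INF_less_iff)
  then show "x \<in> S' + (\<lambda>d. \<alpha> *\<^sub>R d) ` cball 0 1"
    using mem_plus_scaled_cball[OF assms(1)] by (auto simp: ennreal_less_iff intro: less_imp_le)
qed

lemma excess_eq_Inf:
  fixes S S' :: "'a::real_normed_vector set"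
  shows "excess S S' = (INF \<alpha>\<in>{\<alpha>. 0 < \<alpha> \<and> S \<subseteq> S' + (\<lambda>d. \<alpha> *\<^sub>R d) ` cball 0 1}. ennreal \<alpha>)"
    (is "_ = ?I")
proof (rule antisym)
  show "excess S S' \<le> ?I"
    by (rule INF_greatest) (auto intro: excess_le)
  show "?I \<le> excess S S'"
  proof (rule ennreal_le_epsilon)
    fix \<epsilon> :: real
    assume fin: "excess S S' < top" and \<epsilon>: "0 < \<epsilon>"
    obtain r where r: "0 \<le> r" "excess S S' = ennreal r"
      using fin by (cases "excess S S'") auto
    have "S \<subseteq> S' + (\<lambda>d. (r + \<epsilon>) *\<^sub>R d) ` cball 0 1"
      using r \<epsilon> by (intro excess_less_imp_subset) (auto simp: ennreal_less_iff)
    then have "?I \<le> ennreal (r + \<epsilon>)"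
      using r \<epsilon> by (intro INF_lower) auto
    then show "?I \<le> excess S S' + ennreal \<epsilon>"
      using r \<epsilon> by (simp add: ennreal_plus)
  qed
qed

lemma frechet_subdiff_iff:
  fixes G :: "'z::real_normed_vector \<Rightarrow> 'x::real_normed_vector set"
  shows "T \<in> frechet_subdiff K G z0 \<longleftrightarrow>
    (\<forall>\<epsilon>>0. \<exists>\<delta>>0. \<forall>z. norm (z - z0) < \<delta> \<longrightarrow>
       Epi K G z \<subseteq> Epi K G z0 + {blinfun_apply T (z - z0)} + (\<lambda>d. (\<epsilon> * norm (z - z0)) *\<^sub>R d) ` cball 0 1)"
    (is "_ \<longleftrightarrow> (\<forall>\<epsilon>>0. \<exists>\<delta>>0. \<forall>z. _ \<longrightarrow> ?sub \<epsilon> z)")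
proof -
  let ?e = "\<lambda>z. excess (Epi K G z) (Epi K G z0 + {blinfun_apply T (z - z0)})"
  have sub0: "?sub \<epsilon> z0" for \<epsilon>
  proof -
    have "(0::'x) \<in> (\<lambda>d::'x. 0) ` cball 0 1"
      by (rule image_eqI[of _ _ 0]) auto
    then have "S \<subseteq> S + (\<lambda>d::'x. 0) ` cball 0 1" for S :: "'x set"
      by (metis add.commute set_zero_plus2)
    then show ?thesis
      by (simp add: blinfun.zero_right)
  qed
  have quot: "?e z / ennreal (norm (z - z0)) < ennreal c \<longleftrightarrow> ?e z < ennreal (c * norm (z - z0))"
    if "z \<noteq> z0" "0 < c" for z c
    using that by (simp add: divide_less_ennreal ennreal_mult less_top[symmetric])
  show ?thesis
  proof
    assume "T \<in> frechet_subdiff K G z0"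
    then have lim: "((\<lambda>z. ?e z / ennreal (norm (z - z0))) \<longlongrightarrow> 0) (at z0)"
      by (simp add: frechet_subdiff_def)
    show "\<forall>\<epsilon>>0. \<exists>\<delta>>0. \<forall>z. norm (z - z0) < \<delta> \<longrightarrow> ?sub \<epsilon> z"
    proof (intro allI impI)
      fix \<epsilon> :: real assume \<epsilon>: "0 < \<epsilon>"
      then have "\<forall>\<^sub>F z in at z0. ?e z / ennreal (norm (z - z0)) < ennreal \<epsilon>"
        using lim by (intro order_tendstoD) auto
      then obtain \<delta> where \<delta>: "0 < \<delta>"
        "\<And>z. z \<noteq> z0 \<Longrightarrow> dist z z0 < \<delta> \<Longrightarrow> ?e z / ennreal (norm (z - z0)) < ennreal \<epsilon>"
        by (auto simp: eventually_at)
      have "?sub \<epsilon> z" if "norm (z - z0) < \<delta>" for z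
      proof (cases "z = z0")
        case False
        with \<delta>(2)[of z] that \<epsilon> have "?e z < ennreal (\<epsilon> * norm (z - z0))"
          by (simp add: quot dist_norm)
        then show ?thesis
          using False \<epsilon> by (intro excess_less_imp_subset) auto
      qed (use sub0 in simp)
      then show "\<exists>\<delta>>0. \<forall>z. norm (z - z0) < \<delta> \<longrightarrow> ?sub \<epsilon> z"
        using \<delta>(1) by blast
    qed
  next
    assume R: "\<forall>\<epsilon>>0. \<exists>\<delta>>0. \<forall>z. norm (z - z0) < \<delta> \<longrightarrow> ?sub \<epsilon> z"
    have "((\<lambda>z. ?e z / ennreal (norm (z - z0))) \<longlongrightarrow> 0) (at z0)"
    proof (rule order_tendstoI)
      fix a :: ennreal assume "0 < a"
      then obtain c' where "0 < c'" "c' < a"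
        using dense by blast
      then obtain c where c: "0 < c" "ennreal c < a"
        by (cases c') auto
      from R c(1) obtain \<delta> where \<delta>: "0 < \<delta>" "\<And>z. norm (z - z0) < \<delta> \<Longrightarrow> ?sub (c / 2) z"
        by (meson half_gt_zero)
      have "?e z / ennreal (norm (z - z0)) < a" if "z \<noteq> z0" "norm (z - z0) < \<delta>" for z
      proof -
        have "?e z \<le> ennreal (c / 2 * norm (z - z0))"
          using that \<delta>(2)[of z] c by (intro excess_le) auto
        also have "\<dots> < ennreal (c * norm (z - z0))"
          using that c by (intro ennreal_lessI) auto
        finally have "?e z / ennreal (norm (z - z0)) < ennreal c"
          using that c by (simp add: quot)
        with c show ?thesis by simp
      qed
      then show "\<forall>\<^sub>F z in at z0. ?e z / ennreal (norm (z - z0)) < a"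
        using \<delta>(1) by (auto simp: eventually_at dist_norm)
    qed simp
    then show "T \<in> frechet_subdiff K G z0"
      by (simp add: frechet_subdiff_def)
  qed
qed

end

theory Submission
  imports Defs
begin

text \<open>
  Both excesses in the two difference quotients are in fact equal: adding the same weakly
  \<open>K\<close>-compact set to both arguments does not change the excess. If some point \<open>p\<close> had distance
  \<open>> r\<close> to \<open>Q\<close> although the enlarged sets have excess \<open>< r\<close>, then Hahn--Banach separates \<open>p\<close> from the
  convex set \<open>closure Q\<close> with gap at least \<open>r\<close> by a functional of norm at most 1. This functional is
  nonnegative on \<open>K\<close>, since \<open>Q\<close> absorbs \<open>K\<close>, hence attains its minimum on \<open>A\<close>; evaluating it at \<open>p\<close>
  plus a minimiser gives a contradiction.
\<close>

section \<open>Sublinear functionals, the Hahn--Banach theorem and separation\<close>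

definition sublinear :: "('a::real_vector \<Rightarrow> real) \<Rightarrow> bool" where
  "sublinear p \<longleftrightarrow> (\<forall>x y. p (x + y) \<le> p x + p y) \<and> (\<forall>c x. 0 \<le> c \<longrightarrow> p (c *\<^sub>R x) = c * p x)"

lemma sublinear_add: "sublinear p \<Longrightarrow> p (x + y) \<le> p x + p y"
  by (simp add: sublinear_def)

lemma sublinear_scale: "sublinear p \<Longrightarrow> 0 \<le> c \<Longrightarrow> p (c *\<^sub>R x) = c * p x"
  by (simp add: sublinear_def)

lemma sublinear_zero: "sublinear p \<Longrightarrow> p 0 = 0"
  using sublinear_scale[of p 0 0] by simp

lemma sublinear_minus_ge: "sublinear p \<Longrightarrow> - p (- x) \<le> p x"
  using sublinear_add[of p x "- x"] by (simp add: sublinear_zero)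

text \<open>An upper bound suffices for homogeneity: applied with factor \<open>1 / c\<close> at
  \<open>c *\<^sub>R x\<close> it gives the reverse inequality. Functionals defined as infima yield
  such upper bounds directly.\<close>

lemma sublinearI:
  assumes add: "\<And>x y. p (x + y) \<le> p x + p y"
    and zero: "p 0 = 0"
    and scale: "\<And>c x. 0 < c \<Longrightarrow> p (c *\<^sub>R x) \<le> c * p x"
  shows "sublinear p"
proof -
  have "p (c *\<^sub>R x) = c * p x" if "0 \<le> c" for c x
  proof (cases "c = 0")
    case False
    with that have c: "0 < c" by simp
    have "p ((1 / c) *\<^sub>R (c *\<^sub>R x)) \<le> (1 / c) * p (c *\<^sub>R x)"
      using c by (intro scale) simp
    then have "c * p x \<le> p (c *\<^sub>R x)"
      using c by (simp add: field_simps)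
    with scale[OF c, of x] show ?thesis by simp
  qed (simp add: zero)
  with add show ?thesis
    by (simp add: sublinear_def)
qed

lemma sublinear_norm: "sublinear (norm :: 'a::real_normed_vector \<Rightarrow> real)"
  by (simp add: sublinear_def norm_triangle_ineq)

text \<open>With \<open>p = norm\<close> this prepares the separation of \<open>W\<close> from 0; with \<open>W = {y}\<close> and \<open>d = p y\<close> it
  shows that a minimal sublinear functional is odd.\<close>

lemma sublinear_decrease:
  fixes p :: "'a::real_vector \<Rightarrow> real"
  assumes p: "sublinear p" and W: "convex W" "W \<noteq> {}" and d: "\<And>w. w \<in> W \<Longrightarrow> d \<le> p w"
  shows "\<exists>q. sublinear q \<and> (\<forall>x. q x \<le> p x) \<and> (\<forall>w\<in>W. q (- w) \<le> - d)"
proof -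
  \<comment> \<open>The infimum \<open>q\<close> of these values is the largest sublinear functional
    below \<open>p\<close> with \<open>q (- w) \<le> - d\<close> on \<open>W\<close>:
    \<open>t = 0\<close> gives the bound by \<open>p\<close>, and \<open>t = 1\<close> at
    \<open>- w\<close> the bound by \<open>- d\<close>.\<close>
  define V where "V x = {p (x + t *\<^sub>R w) - t * d | t w. 0 \<le> t \<and> w \<in> W}" for x
  define q where "q x = Inf (V x)" for x
  have ne: "V x \<noteq> {}" for x
    using W by (force simp: V_def)
  \<comment> \<open>The assumption \<open>d \<le> p w\<close> enters here; it keeps the infimum
    finite as \<open>t\<close> grows.\<close>
  have lb: "- p (- x) \<le> v" if "v \<in> V x" for x v
  proof -
    from that obtain t w where tw: "0 \<le> t" "w \<in> W" "v = p (x + t *\<^sub>R w) - t * d"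
      by (auto simp: V_def)
    have "t * p w \<le> p (x + t *\<^sub>R w) + p (- x)"
      using sublinear_add[OF p, of "x + t *\<^sub>R w" "- x"] tw by (simp add: sublinear_scale[OF p])
    moreover have "t * d \<le> t * p w"
      using tw d by (intro mult_left_mono) auto
    ultimately show ?thesis
      using tw by simp
  qed
  have bdd: "bdd_below (V x)" for x
    using lb by (rule bdd_belowI)
  have le: "q x \<le> p (x + t *\<^sub>R w) - t * d" if "0 \<le> t" "w \<in> W" for x t w
    unfolding q_def using that by (intro cInf_lower bdd) (auto simp: V_def)
  have ge: "c \<le> q x" if "\<And>t w. 0 \<le> t \<Longrightarrow> w \<in> W \<Longrightarrow> c \<le> p (x + t *\<^sub>R w) - t * d" for c x
    unfolding q_def using that by (intro cInf_greatest ne) (auto simp: V_def)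
  obtain w0 where w0: "w0 \<in> W"
    using W by blast
  have qp: "q x \<le> p x" for x
    using le[of 0 w0 x] w0 by simp
  have "sublinear q"
  proof (rule sublinearI)
    fix x y
    have "q (x + y) - (p (x + t *\<^sub>R w) - t * d) \<le> q y" if t: "0 \<le> t" "w \<in> W" for t :: real and w
    proof (rule ge)
      fix s :: real and v assume s: "0 \<le> s" "v \<in> W"
      \<comment> \<open>Convexity of \<open>W\<close> merges the two multiples into one, so that the
        result is a competitor in the infimum defining \<open>q (x + y)\<close>.\<close>
      have "\<exists>u\<in>W. t *\<^sub>R w + s *\<^sub>R v = (t + s) *\<^sub>R u"
      proof (cases "t + s = 0")
        case False
        with t s have "(t / (t + s)) *\<^sub>R w + (s / (t + s)) *\<^sub>R v \<in> W"
          by (intro convexD[OF W(1)]) (auto simp: add_divide_distrib[symmetric])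
        moreover have "t *\<^sub>R w + s *\<^sub>R v = (t + s) *\<^sub>R ((t / (t + s)) *\<^sub>R w + (s / (t + s)) *\<^sub>R v)"
          using False by (simp add: scaleR_right_distrib)
        ultimately show ?thesis by blast
      next
        case True
        with t s have "t = 0" "s = 0" by auto
        with t show ?thesis by auto
      qed
      then obtain u where u: "u \<in> W" "t *\<^sub>R w + s *\<^sub>R v = (t + s) *\<^sub>R u"
        by blast
      have "q (x + y) \<le> p ((x + y) + (t + s) *\<^sub>R u) - (t + s) * d"
        using t s u by (intro le) auto
      also have "(x + y) + (t + s) *\<^sub>R u = (x + t *\<^sub>R w) + (y + s *\<^sub>R v)"
        by (simp add: u(2)[symmetric])
      also have "p \<dots> \<le> p (x + t *\<^sub>R w) + p (y + s *\<^sub>R v)"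
        by (rule sublinear_add[OF p])
      finally show "q (x + y) - (p (x + t *\<^sub>R w) - t * d) \<le> p (y + s *\<^sub>R v) - s * d"
        by (simp add: algebra_simps)
    qed
    then have "q (x + y) - q y \<le> q x"
      by (intro ge) (simp add: algebra_simps)
    then show "q (x + y) \<le> q x + q y"
      by simp
  next
    have "0 \<le> q 0"
      using ge[of 0 0] d by (simp add: sublinear_scale[OF p] mult_left_mono)
    with qp[of 0] show "q 0 = 0"
      by (simp add: sublinear_zero[OF p])
  next
    fix c :: real and x assume c: "0 < c"
    have "q (c *\<^sub>R x) / c \<le> q x"
    proof (rule ge)
      fix t :: real and w assume t: "0 \<le> t" "w \<in> W"
      have "q (c *\<^sub>R x) \<le> p (c *\<^sub>R x + (c * t) *\<^sub>R w) - (c * t) * d"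
        using c t by (intro le) auto
      also have "c *\<^sub>R x + (c * t) *\<^sub>R w = c *\<^sub>R (x + t *\<^sub>R w)"
        by (simp add: scaleR_right_distrib)
      also have "p \<dots> = c * p (x + t *\<^sub>R w)"
        using c by (simp add: sublinear_scale[OF p])
      finally show "q (c *\<^sub>R x) / c \<le> p (x + t *\<^sub>R w) - t * d"
        using c by (simp add: field_simps)
    qed
    then show "q (c *\<^sub>R x) \<le> c * q x"
      using c by (simp add: field_simps)
  qed
  moreover have "q (- w) \<le> - d" if "w \<in> W" for w
    using le[of 1 w "- w"] that by (simp add: sublinear_zero[OF p])
  ultimately show ?thesis
    using qp by blast
qed

text \<open>The common bound \<open>p\<close> forces every member to be at least
  \<open>- p (- x)\<close> at \<open>x\<close>, so the infimum is finite. Infima do not inherit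
  subadditivity in general; in a chain the smaller of two members serves both arguments.\<close>

lemma sublinear_Inf_chain:
  fixes C :: "('a::real_vector \<Rightarrow> real) set"
  assumes ne: "C \<noteq> {}" and sub: "\<And>g. g \<in> C \<Longrightarrow> sublinear g" and bound: "\<And>g x. g \<in> C \<Longrightarrow> g x \<le> p x"
    and chain: "\<And>g h. g \<in> C \<Longrightarrow> h \<in> C \<Longrightarrow> g \<le> h \<or> h \<le> g"
  defines "u \<equiv> \<lambda>x. INF g\<in>C. g x"
  shows "sublinear u" and "\<And>g. g \<in> C \<Longrightarrow> u \<le> g"
proof -
  have "- p (- x) \<le> g x" if "g \<in> C" for g x
    using sublinear_minus_ge[OF sub[OF that], of x] bound[OF that, of "- x"] by simp
  then have bdd: "bdd_below ((\<lambda>g. g x) ` C)" for x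
    by (intro bdd_belowI2)
  have le: "u x \<le> g x" if "g \<in> C" for g x
    unfolding u_def using that by (intro cINF_lower bdd)
  have ge: "c \<le> u x" if "\<And>g. g \<in> C \<Longrightarrow> c \<le> g x" for c x
    unfolding u_def using that by (intro cINF_greatest ne)
  show "u \<le> g" if "g \<in> C" for g
    using le[OF that] by (simp add: le_fun_def)
  show "sublinear u"
  proof (rule sublinearI)
    fix x y
    have "u (x + y) - g x \<le> u y" if g: "g \<in> C" for g
    proof (rule ge)
      fix h assume h: "h \<in> C"
      obtain k where k: "k \<in> C" "k \<le> g" "k \<le> h"
        using chain[OF g h] g h by blast
      have "u (x + y) \<le> k x + k y"
        using le[OF k(1), of "x + y"] sublinear_add[OF sub[OF k(1)], of x y] by simp
      also have "\<dots> \<le> g x + h y"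
        using k by (intro add_mono) (auto simp: le_fun_def)
      finally show "u (x + y) - g x \<le> h y"
        by simp
    qed
    then have "u (x + y) - u y \<le> u x"
      by (intro ge) (simp add: algebra_simps)
    then show "u (x + y) \<le> u x + u y"
      by simp
  next
    show "u 0 = 0"
      unfolding u_def using ne by (simp add: sublinear_zero[OF sub] cong: INF_cong_simp)
  next
    fix c :: real and x assume c: "0 < c"
    have "u (c *\<^sub>R x) / c \<le> u x"
    proof (rule ge)
      fix g assume g: "g \<in> C"
      show "u (c *\<^sub>R x) / c \<le> g x"
        using le[OF g, of "c *\<^sub>R x"] c by (simp add: sublinear_scale[OF sub[OF g]] field_simps)
    qed
    then show "u (c *\<^sub>R x) \<le> c * u x"
      using c by (simp add: field_simps)
  qed
qed

text \<open>By minimality the functional from \<open>sublinear_decrease\<close> is \<open>f\<close>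
  itself, so \<open>f\<close> is odd; oddness turns subadditivity into additivity and extends
  homogeneity to negative factors.\<close>

lemma minimal_sublinear_imp_linear:
  fixes f :: "'a::real_vector \<Rightarrow> real"
  assumes f: "sublinear f" and min: "\<And>g. sublinear g \<Longrightarrow> g \<le> f \<Longrightarrow> g = f"
  shows "linear f"
proof -
  have minus: "f (- y) = - f y" for y
  proof -
    obtain q where q: "sublinear q" "\<forall>x. q x \<le> f x" "q (- y) \<le> - f y"
      using sublinear_decrease[OF f, of "{y}" "f y"] by auto
    then have "q = f"
      by (intro min) (auto simp: le_fun_def)
    with q(3) sublinear_minus_ge[OF f, of y] show ?thesis
      by simp
  qed
  show ?thesis
  proof (rule linearI)
    fix x y
    show "f (x + y) = f x + f y"
      using sublinear_add[OF f, of x y] sublinear_add[OF f, of "x + y" "- y"] minus[of y] by simp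
  next
    fix c x
    show "f (c *\<^sub>R x) = c *\<^sub>R f x"
    proof (cases "0 \<le> c")
      case False
      then show ?thesis
        using sublinear_scale[OF f, of "- c" x] minus[of "c *\<^sub>R x"] by simp
    qed (simp add: sublinear_scale[OF f])
  qed
qed

text \<open>Zorn's lemma for the reversed pointwise order gives a minimal sublinear functional below
  \<open>p\<close>, and minimal ones are linear. Infima bound nonempty chains; \<open>p\<close>
  bounds the empty one.\<close>

theorem Hahn_Banach_sublinear:
  fixes p :: "'a::real_vector \<Rightarrow> real"
  assumes p: "sublinear p"
  obtains f where "linear f" "\<And>x. f x \<le> p x"
proof -
  define S where "S = {g. sublinear g \<and> g \<le> p}"
  have "\<exists>m\<in>S. \<forall>a\<in>S. a \<le> m \<longrightarrow> a = m"
  proof (rule predicate_Zorn)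
    show "partial_order_on S (relation_of (\<lambda>g h. h \<le> g) S)"
      by (rule partial_order_on_relation_ofI) auto
  next
    fix C assume C: "C \<in> Chains (relation_of (\<lambda>g h. h \<le> g) S)"
    then have chain: "g \<le> h \<or> h \<le> g" and sub: "g \<in> S" if "g \<in> C" "h \<in> C" for g h
      using that by (auto simp: Chains_def relation_of_def)
    show "\<exists>u\<in>S. \<forall>a\<in>C. u \<le> a"
    proof (cases "C = {}")
      case True
      with p show ?thesis by (auto simp: S_def)
    next
      case False
      then obtain g0 where g0: "g0 \<in> C" by blast
      let ?u = "\<lambda>x. INF g\<in>C. g x"
      have S: "sublinear g" "g x \<le> p x" if "g \<in> C" for g x
        using sub[OF that that] by (auto simp: S_def le_fun_def)
      have "sublinear ?u"
        by (rule sublinear_Inf_chain(1)[where p = p]) (use False S chain in blast)+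
      moreover have le: "?u \<le> g" if "g \<in> C" for g
        by (rule sublinear_Inf_chain(2)[where p = p]) (use False S chain that in blast)+
      moreover have "?u \<le> p"
        using le[OF g0] sub[OF g0 g0] by (auto simp: S_def intro: order_trans)
      ultimately show ?thesis
        unfolding S_def by blast
    qed
  qed
  then obtain f where f: "sublinear f" "f \<le> p" "\<And>g. g \<in> S \<Longrightarrow> g \<le> f \<Longrightarrow> g = f"
    by (auto simp: S_def)
  then have "linear f"
    by (intro minimal_sublinear_imp_linear) (auto simp: S_def)
  with f(2) show ?thesis
    by (intro that) (auto simp: le_fun_def)
qed

text \<open>The gap is built into the sublinear bound first: the norm is decreased to
  \<open>q\<close> with \<open>q (- w) \<le> - d\<close>, and any linear \<open>f\<close> below
  \<open>q\<close> then has \<open>d \<le> f w\<close> by oddness.\<close>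

lemma separate_convex_from_zero:
  fixes W :: "'a::real_normed_vector set"
  assumes W: "convex W" "W \<noteq> {}" and d: "\<And>w. w \<in> W \<Longrightarrow> d \<le> norm w"
  obtains f :: "'a \<Rightarrow> real" where "bounded_linear f" "\<And>x. f x \<le> norm x" "\<And>w. w \<in> W \<Longrightarrow> d \<le> f w"
proof -
  obtain q where q: "sublinear q" "\<And>x. q x \<le> norm x" "\<And>w. w \<in> W \<Longrightarrow> q (- w) \<le> - d"
    using sublinear_decrease[OF sublinear_norm W d] by blast
  obtain f where f: "linear f" "\<And>x. f x \<le> q x"
    using Hahn_Banach_sublinear[OF q(1)] by blast
  have le: "f x \<le> norm x" for x
    using f(2) q(2) order_trans by blast
  have neg: "f (- x) = - f x" for x
    by (rule linear_neg[OF f(1)])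
  have "norm (f x) \<le> norm x * 1" for x
    using le[of x] le[of "- x"] by (simp add: neg abs_le_iff)
  then have "bounded_linear f"
    using f(1) by (intro bounded_linear.intro bounded_linear_axioms.intro) blast+
  moreover have "d \<le> f w" if "w \<in> W" for w
    using f(2)[of "- w"] q(3)[OF that] neg[of w] by simp
  ultimately show ?thesis
    using le by (intro that)
qed

section \<open>Minima of functionals on weakly \<open>K\<close>-compact sets\<close>

lemma openin_weak_topology_halfspace:
  fixes f :: "'a::real_normed_vector \<Rightarrow> real"
  assumes "bounded_linear f"
  shows "openin weak_topology {x. c < f x}"
proof -
  have "openin weak_topology (f -` {c<..})"
    unfolding weak_topology_def using assms
    by (intro topology_generated_by_Basis CollectI exI[of _ f] exI[of _ "{c<..}"]) simp
  then show ?thesis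
    by (simp add: vimage_def)
qed

text \<open>Without a minimiser the sets \<open>{x. f a < f x} + K\<close> with \<open>a\<close> in
  \<open>A\<close> cover \<open>A\<close>. In a finite subcover the index \<open>a\<close> with
  least \<open>f a\<close> lies in the set of some index \<open>b\<close>; as \<open>f\<close> is
  nonnegative on \<open>K\<close>, this gives \<open>f b < f a\<close>.\<close>

lemma weakly_K_compact_attains_min:
  fixes A K :: "'a::real_normed_vector set" and f :: "'a \<Rightarrow> real"
  assumes A: "weakly_K_compact K A" "A \<noteq> {}" and K: "0 \<in> K"
    and f: "bounded_linear f" and nonneg: "\<And>k. k \<in> K \<Longrightarrow> 0 \<le> f k"
  obtains a where "a \<in> A" "\<And>x. x \<in> A \<Longrightarrow> f a \<le> f x"
proof -
  have "\<exists>a\<in>A. \<forall>x\<in>A. f a \<le> f x"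
  proof (rule ccontr)
    assume no: "\<not> ?thesis"
    let ?U = "\<lambda>a. {x. f a < f x} + K"
    have "A \<subseteq> \<Union> (?U ` A)"
    proof
      fix x assume "x \<in> A"
      with no obtain a where "a \<in> A" "f a < f x"
        by (meson not_le)
      then have "x + 0 \<in> ?U a"
        using K by (intro set_plus_intro) auto
      with \<open>a \<in> A\<close> show "x \<in> \<Union> (?U ` A)"
        by auto
    qed
    moreover have "?U ` A \<subseteq> {U + K | U. openin weak_topology U}"
      using openin_weak_topology_halfspace[OF f] by blast
    ultimately obtain D where D: "D \<subseteq> ?U ` A" "finite D" "A \<subseteq> \<Union>D"
      using A(1) unfolding weakly_K_compact_def by meson
    then obtain S where S: "S \<subseteq> A" "finite S" "D = ?U ` S"
      by (meson finite_subset_image)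
    with D A(2) have "S \<noteq> {}"
      by auto
    with S(2) have "Min (f ` S) \<in> f ` S"
      by (intro Min_in) auto
    then obtain a where "a \<in> S" "f a = Min (f ` S)"
      by auto
    with S(2) have a: "a \<in> S" "\<And>x. x \<in> S \<Longrightarrow> f a \<le> f x"
      by auto
    with S D obtain b where b: "b \<in> S" "a \<in> ?U b"
      by auto
    then obtain x k where "a = x + k" "f b < f x" "k \<in> K"
      by (auto simp: set_plus_def)
    then have "f b < f a"
      using nonneg[of k] f by (simp add: linear_add bounded_linear.linear)
    with a(2)[OF b(1)] show False
      by simp
  qed
  with that show ?thesis by blast
qed

section \<open>The excess under addition of a common set\<close>

lemma excess_plus_le: "excess (P + A) (Q + A) \<le> excess P Q"
  for P Q A :: "'a::real_normed_vector set"
  unfolding excess_def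
proof (rule SUP_least)
  fix x assume "x \<in> P + A"
  then obtain p a where x: "p \<in> P" "a \<in> A" "x = p + a"
    by (auto simp: set_plus_def)
  have "(INF y\<in>Q + A. ennreal (dist x y)) \<le> (INF y\<in>Q. ennreal (dist p y))"
  proof (rule INF_greatest)
    fix y assume "y \<in> Q"
    then have "(INF y\<in>Q + A. ennreal (dist x y)) \<le> ennreal (dist x (y + a))"
      using x by (intro INF_lower set_plus_intro)
    then show "(INF y\<in>Q + A. ennreal (dist x y)) \<le> ennreal (dist p y)"
      using x by (simp add: dist_norm)
  qed
  also have "\<dots> \<le> (SUP x\<in>P. INF y\<in>Q. ennreal (dist x y))"
    using x by (intro SUP_upper)
  finally show "(INF y\<in>Q + A. ennreal (dist x y)) \<le> (SUP x\<in>P. INF y\<in>Q. ennreal (dist x y))" .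
qed

lemma excess_plus_ge:
  fixes P Q A K :: "'a::real_normed_vector set"
  assumes A: "weakly_K_compact K A" "A \<noteq> {}" and K: "cone K" "0 \<in> K"
    and Q: "convex (closure Q)" "Q + K \<subseteq> Q"
  shows "excess P Q \<le> excess (P + A) (Q + A)"
proof (rule ccontr)
  assume "\<not> ?thesis"
  then have less: "excess (P + A) (Q + A) < excess P Q"
    by simp
  \<comment> \<open>Real levels \<open>r < s\<close> are inserted strictly between the two excesses:
    \<open>p\<close> has distance at least \<open>s\<close> from every point of \<open>Q\<close>,
    while each \<open>p + a\<close> with \<open>a\<close> in \<open>A\<close> is within
    \<open>r\<close> of \<open>Q + A\<close>.\<close>
  obtain s' where s': "excess (P + A) (Q + A) < s'" "s' < excess P Q"
    using dense[OF less] by blast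
  then obtain p where p: "p \<in> P" "s' < (INF y\<in>Q. ennreal (dist p y))"
    unfolding excess_def by (auto simp: less_SUP_iff)
  obtain s where s: "0 < s" "s' = ennreal s"
    using s' le_less_trans[OF zero_le s'(1)] by (cases s') auto
  obtain r' where r': "excess (P + A) (Q + A) < r'" "r' < s'"
    using dense[OF s'(1)] by blast
  obtain r where r: "0 < r" "r' = ennreal r"
    using r' le_less_trans[OF zero_le r'(1)] by (cases r') auto
  have rs: "r < s"
    using r'(2) r s by (simp add: ennreal_less_iff)
  have near: "\<exists>q\<in>Q. \<exists>a'\<in>A. dist (p + a) (q + a') \<le> r" if "a \<in> A" for a
  proof -
    have "p + a \<in> (Q + A) + (\<lambda>d. r *\<^sub>R d) ` cball 0 1"
      using excess_less_imp_subset[OF r(1), of "P + A" "Q + A"] r' r p that by auto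
    then show ?thesis
      unfolding mem_plus_scaled_cball[OF r(1)] by (auto simp: set_plus_def)
  qed
  with A(2) obtain q0 where q0: "q0 \<in> Q"
    by blast
  have "s \<le> dist p y" if "y \<in> Q" for y
  proof -
    have "ennreal s < ennreal (dist p y)"
      using p(2) s(2) INF_lower[OF that, of "\<lambda>y. ennreal (dist p y)"] by simp
    then show ?thesis
      using s(1) by (simp add: ennreal_less_iff)
  qed
  \<comment> \<open>Convexity is given for \<open>closure Q\<close>, so the distance bound is
    carried over to it through a closed set.\<close>
  then have "Q \<subseteq> {y. s \<le> dist p y}"
    by blast
  then have "closure Q \<subseteq> {y. s \<le> dist p y}"
    by (intro closure_minimal closed_Collect_le continuous_intros)
  then have far: "s \<le> norm w" if "w \<in> (\<lambda>y. y - p) ` closure Q" for w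
    using that by (auto simp: dist_norm norm_minus_commute)
  have conv: "convex ((\<lambda>y. y - p) ` closure Q)"
    using Q(1) by (rule convex_translation_subtract)
  have ne: "(\<lambda>y. y - p) ` closure Q \<noteq> {}"
    using q0 closure_subset by blast
  obtain f :: "'a \<Rightarrow> real" where f: "bounded_linear f" "\<And>x. f x \<le> norm x"
      "\<And>w. w \<in> (\<lambda>y. y - p) ` closure Q \<Longrightarrow> s \<le> f w"
    using separate_convex_from_zero[OF conv ne far] by blast
  interpret f: bounded_linear f by (rule f(1))
  have sep: "s \<le> f q - f p" if "q \<in> Q" for q
    using f(3)[of "q - p"] subsetD[OF closure_subset that] by (simp add: f.diff)
  have "0 \<le> f k" if k: "k \<in> K" for k
  proof (rule ccontr)
    assume "\<not> 0 \<le> f k"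
    then have neg: "f k < 0" by simp
    \<comment> \<open>This \<open>t\<close> makes \<open>f (q0 + t *\<^sub>R k)\<close> equal to
      \<open>f p\<close>, against the positive gap \<open>s\<close>.\<close>
    define t where "t = (f q0 - f p) / (- f k)"
    have t0: "0 \<le> t"
      unfolding t_def using sep[OF q0] s neg by (intro divide_nonneg_pos) auto
    then have "q0 + t *\<^sub>R k \<in> Q"
      using q0 k K Q(2) by (meson mem_cone set_plus_intro subsetD)
    from sep[OF this] have "s \<le> f q0 + t * f k - f p"
      by (simp add: f.add f.scaleR)
    also have "\<dots> = 0"
      using neg by (simp add: t_def)
    finally show False
      using s by simp
  qed
  then obtain a where a: "a \<in> A" "\<And>x. x \<in> A \<Longrightarrow> f a \<le> f x"
    using weakly_K_compact_attains_min[OF A K(2) f(1)] by blast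
  from near[OF a(1)] obtain q a' where q: "q \<in> Q" "a' \<in> A" "dist (p + a) (q + a') \<le> r"
    by blast
  \<comment> \<open>Since \<open>f a \<le> f a'\<close>, this estimate leaves
    \<open>f q - f p \<le> r < s\<close>, against the separation.\<close>
  have "f ((q + a') - (p + a)) \<le> norm ((q + a') - (p + a))"
    by (rule f(2))
  also have "\<dots> \<le> r"
    using q(3) by (simp add: dist_norm norm_minus_commute)
  finally have "f q + f a' - (f p + f a) \<le> r"
    by (simp only: f.add f.diff)
  with sep[OF q(1)] a(2)[OF q(2)] rs show False
    by simp
qed

text \<open>Bridges the hypothesis on \<open>closure (F z0) + K\<close> and the convexity of the
  closure of \<open>F z0 + K\<close> that \<open>excess_plus_ge\<close> asks for: both sets have the
  same closure.\<close>

lemma convex_closure_plus: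
  fixes C K :: "'a::real_normed_vector set"
  assumes "convex (closure C + K)"
  shows "convex (closure (C + K))"
proof -
  have "closure C + K \<subseteq> closure (C + K)"
    using closure_sum[of C K] closure_subset[of K] by (meson order_refl set_plus_mono2 order_trans)
  then have "closure (closure C + K) = closure (C + K)"
    by (metis closure_closure closure_mono closure_subset order_refl set_plus_mono2 subset_antisym)
  with assms show ?thesis
    by (metis convex_closure)
qed

theorem proposition3p10:
  fixes K A :: "'x::real_normed_vector set"
    and F :: "'z::real_normed_vector \<Rightarrow> 'x set"
    and z0 :: 'z
  assumes "closed K" and "convex K" and "cone K" and "pointed K"
    and "A \<noteq> {}" and "weakly_K_compact K A"
    and "K_convex K (closure (F z0))"
  shows "frechet_subdiff K (\<lambda>z. F z + A) z0 = frechet_subdiff K F z0"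
proof -
  \<comment> \<open>A \<open>cone\<close> in the library's sense may be empty; pointedness supplies
    0.\<close>
  have K0: "0 \<in> K"
    using assms(4) by (auto simp: pointed_def)
  have KK: "K + K \<subseteq> K"
    using assms(2,3) convex_cone[of K] by (auto simp: set_plus_def)
  \<comment> \<open>Equality for every \<open>z\<close> and every translation \<open>v\<close> makes
    the two difference quotients agree pointwise, so no limit has to be estimated.\<close>
  have "excess (Epi K (\<lambda>z. F z + A) z) (Epi K (\<lambda>z. F z + A) z0 + {v})
      = excess (Epi K F z) (Epi K F z0 + {v})" for z v
  proof -
    let ?Q = "F z0 + K + {v}"
    have "?Q = (+) v ` (F z0 + K)"
      by (auto simp: set_plus_def image_def add.commute)
    then have "closure ?Q = (+) v ` closure (F z0 + K)"
      by (simp add: closure_translation)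
    then have "convex (closure ?Q)"
      using convex_closure_plus assms(7) by (simp add: K_convex_def convex_translation_eq)
    moreover have "?Q + K \<subseteq> ?Q"
    proof -
      have "?Q + K = (F z0 + {v}) + (K + K)"
        by (simp add: ac_simps)
      also have "\<dots> \<subseteq> (F z0 + {v}) + K"
        using KK by (intro set_plus_mono2) auto
      also have "\<dots> = ?Q"
        by (simp add: ac_simps)
      finally show ?thesis .
    qed
    ultimately have "excess (F z + K + A) (?Q + A) = excess (F z + K) ?Q"
      using assms K0 by (intro antisym excess_plus_le excess_plus_ge)
    then show ?thesis
      by (simp add: Epi_def ac_simps)
  qed
  then show ?thesis
    by (simp add: frechet_subdiff_def)
qed

end
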